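(* Let $R$ be a unital commutative ring and let $M$ be an $R$-module with generating set $\{e_i : i \in I\}$. Assume that for every integer $n$ with $1 \leqslant n \leqslant |I|$, the element $n = 1 + \cdots + 1$ ($n$ times) of $R$ is not a zerodivisor. For every finite subset $J \subseteq I$, fix a vector $m_J := \sum_{j \in J} c_j^J e_j \in M$, where every $c_j^J \in R$ is a non-zerodivisor. Let $f : M \to R$ be any map such that the restriction of $f$ to each of the following lines is affine-linear: \[ m_0 + R e_i = \{ m_0 + r e_i : r \in R \} \quad \text{for all } m_0 \in M \text{ and all } i \in I, \] \[ R m_J = \{ r m_J : r \in R \} \quad \text{for all finite } J \subseteq I \text{ with } |J| \geqslant 2. \] Then $f$ is affine-linear on $M$.
   Context: Let $R$ be a unital commutative ring, $N \leqslant M$ two $R$-modules, and $m_0 \in M$. An $R$-valued function $f$ on the affine submodule $\ell := m_0 + N \subseteq M$ is called affine-linear if for all $m_1 \in \ell$, the map $f_{m_1} : N \to R$, $n \mapsto f(n + m_1) - f(m_1)$, is $R$-linear. (The case $N = Re$ gives affine-linearity along the line $m_0 + Re$; the case $N = M$ gives affine-linearity on $M$.) *)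

theory Defs
  imports "HOL-Algebra.Module" "HOL-Algebra.AbelCoset" "HOL.Hull"
begin

definition nonzerodivisor :: "('a, 'c) ring_scheme \<Rightarrow> 'a \<Rightarrow> bool" where
  "nonzerodivisor R a \<longleftrightarrow>
     a \<in> carrier R \<and> (\<forall>b\<in>carrier R. a \<otimes>\<^bsub>R\<^esub> b = \<zero>\<^bsub>R\<^esub> \<longrightarrow> b = \<zero>\<^bsub>R\<^esub>)"

definition submodule_generated ::
    "('a, 'c) ring_scheme \<Rightarrow> ('a, 'b, 'd) module_scheme \<Rightarrow> 'b set \<Rightarrow> 'b set" where
  "submodule_generated R M S = (\<lambda>N. submodule N R M) hull S"

definition cyclic_submodule ::
    "('a, 'c) ring_scheme \<Rightarrow> ('a, 'b, 'd) module_scheme \<Rightarrow> 'b \<Rightarrow> 'b set" where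
  "cyclic_submodule R M x = {r \<odot>\<^bsub>M\<^esub> x | r. r \<in> carrier R}"

lemma (in module) cyclic_submodule_is_submodule:
  assumes x: "x \<in> carrier M"
  shows "submodule (cyclic_submodule R M x) R M"
proof (rule submoduleI)
  show "cyclic_submodule R M x \<subseteq> carrier M"
    using x by (auto simp: cyclic_submodule_def)
  show "\<zero>\<^bsub>M\<^esub> \<in> cyclic_submodule R M x"
    unfolding cyclic_submodule_def using x smult_l_null[OF x] R.zero_closed by force
  show "\<ominus>\<^bsub>M\<^esub> a \<in> cyclic_submodule R M x" if "a \<in> cyclic_submodule R M x" for a
    using that x unfolding cyclic_submodule_def
    by (auto simp: smult_l_minus[symmetric])
  show "a \<oplus>\<^bsub>M\<^esub> b \<in> cyclic_submodule R M x"
    if "a \<in> cyclic_submodule R M x" "b \<in> cyclic_submodule R M x" for a b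
    using that x unfolding cyclic_submodule_def
    by (auto simp: smult_l_distr[symmetric])
  show "a \<odot>\<^bsub>M\<^esub> y \<in> cyclic_submodule R M x"
    if "a \<in> carrier R" "y \<in> cyclic_submodule R M x" for a y
    using that x unfolding cyclic_submodule_def
    by (auto simp: smult_assoc1[symmetric])
qed

(* R-linearity of g : N -> R, with N a submodule of M; values of g outside N are irrelevant. *)
definition linear_functional_on ::
    "('a, 'c) ring_scheme \<Rightarrow> ('a, 'b, 'd) module_scheme \<Rightarrow> 'b set \<Rightarrow> ('b \<Rightarrow> 'a) \<Rightarrow> bool" where
  "linear_functional_on R M N g \<longleftrightarrow>
     g \<in> N \<rightarrow> carrier R \<and>
     (\<forall>x\<in>N. \<forall>y\<in>N. g (x \<oplus>\<^bsub>M\<^esub> y) = g x \<oplus>\<^bsub>R\<^esub> g y) \<and>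
     (\<forall>r\<in>carrier R. \<forall>x\<in>N. g (r \<odot>\<^bsub>M\<^esub> x) = r \<otimes>\<^bsub>R\<^esub> g x)"

(* Meaningful when N is a submodule of M and m0 is in M: f is affine-linear on the coset m0 + N. *)
definition affine_linear_on ::
    "('a, 'c) ring_scheme \<Rightarrow> ('a, 'b, 'd) module_scheme \<Rightarrow> 'b \<Rightarrow> 'b set \<Rightarrow> ('b \<Rightarrow> 'a) \<Rightarrow> bool" where
  "affine_linear_on R M m0 N f \<longleftrightarrow>
     (\<forall>m1 \<in> m0 <+\<^bsub>M\<^esub> N.
        linear_functional_on R M N (\<lambda>n. f (n \<oplus>\<^bsub>M\<^esub> m1) \<ominus>\<^bsub>R\<^esub> f m1))"

end

theory Submission
  imports Defs
begin

text \<open>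
  After subtracting \<open>f 0\<close>, let \<open>h\<close> be the defect of linearity of \<open>f\<close> on the combinations
  \<open>\<Sum>j\<in>J. r j * e j\<close>, as a function of the coefficients, and induct on \<open>J\<close>. Affinity along the
  directions \<open>e j\<close> and the induction hypothesis for \<open>J - {j}\<close> make \<open>h\<close> homogeneous in each
  coefficient separately, so \<open>h r = (\<Prod>j\<in>J. r j) * h 1\<close>. On the line through \<open>m J\<close> the value \<open>h (t * c)\<close>
  is thus both \<open>t ^ n * h c\<close> and \<open>t * h c\<close>, where \<open>n = card J\<close>. For \<open>n \<ge> 2\<close>, the \<open>n\<close>-th finite difference of
  \<open>(t ^ n - t) * h c = 0\<close> along the integers gives \<open>fact n * h c = 0\<close>; hence \<open>h c = 0\<close>, then
  \<open>h 1 = 0\<close>, and \<open>h = 0\<close>.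
\<close>

section \<open>Finite differences\<close>

text \<open>The operator acts on functions on a whole type. It is applied to polynomials on
  \<open>int\<close>, and only the resulting integers are mapped into the carrier-based ring
  \<open>R\<close>.\<close>

definition forward_diff :: "('a::comm_ring_1 \<Rightarrow> 'a) \<Rightarrow> 'a \<Rightarrow> 'a" where
  "forward_diff f x = f (x + 1) - f x"

lemma forward_diff_funpow_Suc:
  "(forward_diff ^^ Suc m) f x = (forward_diff ^^ m) f (x + 1) - (forward_diff ^^ m) f x"
  by (simp add: forward_diff_def)

lemma forward_diff_funpow_diff:
  "(forward_diff ^^ m) (\<lambda>x. f x - g x) = (\<lambda>x. (forward_diff ^^ m) f x - (forward_diff ^^ m) g x)"
  by (induction m) (auto simp: forward_diff_def fun_eq_iff)

text \<open>This is the Leibniz rule for iterated differences when one factor is the identity, whose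
  second difference vanishes. At \<open>m = 0\<close> the truncated exponent \<open>m - 1\<close> is
  harmless because its coefficient is zero.\<close>

lemma forward_diff_funpow_mult_id:
  "(forward_diff ^^ m) (\<lambda>x. x * f x) x =
     x * (forward_diff ^^ m) f x + of_nat m * (forward_diff ^^ (m - 1)) f (x + 1)"
proof (induction m arbitrary: x)
  case (Suc m)
  have "of_nat m * ((forward_diff ^^ (m - 1)) f (x + 1 + 1) - (forward_diff ^^ (m - 1)) f (x + 1)) =
        of_nat m * (forward_diff ^^ m) f (x + 1)"
    by (cases m) (simp_all add: forward_diff_def)
  then show ?case
    by (simp add: Suc forward_diff_funpow_Suc algebra_simps del: funpow.simps)
qed simp

text \<open>Apply the Leibniz rule to \<open>x * x ^ n\<close>. By induction the \<open>n\<close>-th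
  difference of \<open>x ^ n\<close> is constant, so the term with one more difference vanishes and
  the other contributes the factor \<open>Suc n\<close>.\<close>

lemma forward_diff_funpow_power:
  "(forward_diff ^^ n) (\<lambda>x. x ^ n) x = fact n"
proof (induction n arbitrary: x)
  case (Suc n)
  have "(forward_diff ^^ Suc n) (\<lambda>x. x ^ n) x = 0"
    by (simp add: forward_diff_funpow_Suc Suc del: funpow.simps)
  then show ?case
    using forward_diff_funpow_mult_id[of "Suc n" "\<lambda>x. x ^ n" x]
    by (simp add: Suc del: funpow.simps)
qed simp

lemma forward_diff_funpow_id:
  assumes "2 \<le> n"
  shows "(forward_diff ^^ n) (\<lambda>x. x) x = 0"
  using assms
proof (induction n arbitrary: x rule: dec_induct)
  case base
  show ?case by (simp add: forward_diff_def numeral_2_eq_2)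
qed (simp add: forward_diff_def)

text \<open>Iterated differences are built from values of \<open>f\<close> by subtraction alone.
  This serves to pass from annihilation by all values of a polynomial to annihilation by its
  differences.\<close>

lemma forward_diff_funpow_closed:
  assumes "\<And>x. P (f x)" and "\<And>x y. P x \<Longrightarrow> P y \<Longrightarrow> P (x - y)"
  shows "P ((forward_diff ^^ m) f x)"
proof (induction m arbitrary: x)
  case (Suc m)
  then show ?case
    unfolding forward_diff_funpow_Suc by (intro assms(2))
qed (simp add: assms(1))

section \<open>Non-zerodivisors\<close>

lemma nonzerodivisor_closed: "nonzerodivisor R a \<Longrightarrow> a \<in> carrier R"
  by (simp add: nonzerodivisor_def)

lemma nonzerodivisorD:
  "nonzerodivisor R a \<Longrightarrow> b \<in> carrier R \<Longrightarrow> a \<otimes>\<^bsub>R\<^esub> b = \<zero>\<^bsub>R\<^esub> \<Longrightarrow> b = \<zero>\<^bsub>R\<^esub>"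
  by (simp add: nonzerodivisor_def)

context cring
begin

lemma minus_eq_zeroD:
  assumes "a \<ominus> b = \<zero>" "a \<in> carrier R" "b \<in> carrier R"
  shows "a = b"
  using assms minus_equality[of a "\<ominus> b"] by (simp add: a_minus_def)

lemma nonzerodivisor_one: "nonzerodivisor R \<one>"
  by (simp add: nonzerodivisor_def)

lemma nonzerodivisor_mult:
  "nonzerodivisor R a \<Longrightarrow> nonzerodivisor R b \<Longrightarrow> nonzerodivisor R (a \<otimes> b)"
  using m_assoc unfolding nonzerodivisor_def by (metis m_closed)

lemma nonzerodivisor_finprod:
  assumes "finite A" "\<And>x. x \<in> A \<Longrightarrow> nonzerodivisor R (a x)"
  shows "nonzerodivisor R (finprod R a A)"
  using assms
proof (induction A rule: finite_induct)
  case (insert x A)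
  then have "a \<in> A \<rightarrow> carrier R" "a x \<in> carrier R"
    by (auto intro: nonzerodivisor_closed)
  with insert show ?case
    by (simp add: nonzerodivisor_mult)
qed (simp add: nonzerodivisor_one)

section \<open>The canonical map from the integers to the ring\<close>

lemma add_pow_int_one_mult:
  fixes k l :: int
  shows "[(k * l)] \<cdot>\<^bsub>R\<^esub> \<one> = ([k] \<cdot>\<^bsub>R\<^esub> \<one>) \<otimes> ([l] \<cdot>\<^bsub>R\<^esub> \<one>)"
  by (simp add: add_pow_ldistr_int add.int_pow_pow mult.commute)

lemma add_pow_int_one_power:
  fixes k :: int
  shows "[(k ^ n)] \<cdot>\<^bsub>R\<^esub> \<one> = ([k] \<cdot>\<^bsub>R\<^esub> \<one>) [^] n"
proof (induction n)
  case (Suc n)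
  then show ?case by (simp add: add_pow_int_one_mult m_comm)
qed simp

text \<open>A factorial is the product of the integers up to \<open>n\<close>, and non-zerodivisors
  are closed under products. The conclusion uses integer multiples, as finite differences over
  \<open>int\<close> produce them, while the hypothesis counts with natural numbers.\<close>

lemma nonzerodivisor_fact:
  assumes "\<And>k::nat. 1 \<le> k \<Longrightarrow> k \<le> n \<Longrightarrow> nonzerodivisor R ([k] \<cdot>\<^bsub>R\<^esub> \<one>)"
  shows "nonzerodivisor R ([(fact n :: int)] \<cdot>\<^bsub>R\<^esub> \<one>)"
  using assms
proof (induction n)
  case (Suc n)
  have "[(fact (Suc n) :: int)] \<cdot>\<^bsub>R\<^esub> \<one> = ([(int (Suc n))] \<cdot>\<^bsub>R\<^esub> \<one>) \<otimes> ([(fact n :: int)] \<cdot>\<^bsub>R\<^esub> \<one>)"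
    by (simp only: fact_Suc add_pow_int_one_mult of_nat_id)
  moreover have "[(int (Suc n))] \<cdot>\<^bsub>R\<^esub> \<one> = [(Suc n)] \<cdot>\<^bsub>R\<^esub> \<one>"
    by (simp only: add_pow_int_ge[of "int (Suc n)" R] of_nat_0_le_iff nat_int)
  ultimately show ?case
    using Suc by (simp only: nonzerodivisor_mult le_SucI le_refl One_nat_def Suc_le_mono zero_le)
qed (simp add: nonzerodivisor_one)

section \<open>Homogeneity in scalars and in coefficients\<close>

text \<open>The integers whose image in \<open>R\<close> annihilates \<open>D\<close> are closed
  under subtraction and, by \<open>lin\<close>, contain every \<open>k ^ n - k\<close>. Hence they
  contain the \<open>n\<close>-th difference of this polynomial, which is \<open>fact n\<close>
  because \<open>2 \<le> n\<close> kills the linear term; and \<open>fact n\<close> can be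
  cancelled.\<close>

lemma monomial_linear_imp_zero:
  assumes D: "D \<in> carrier R" and n: "2 \<le> n"
    and lin: "\<And>t. t \<in> carrier R \<Longrightarrow> t [^] n \<otimes> D = t \<otimes> D"
    and nzd: "\<And>k::nat. 1 \<le> k \<Longrightarrow> k \<le> n \<Longrightarrow> nonzerodivisor R ([k] \<cdot>\<^bsub>R\<^esub> \<one>)"
  shows "D = \<zero>"
proof -
  have diff: "([(k - l)] \<cdot>\<^bsub>R\<^esub> \<one>) \<otimes> D = ([k] \<cdot>\<^bsub>R\<^esub> \<one>) \<otimes> D \<ominus> ([l] \<cdot>\<^bsub>R\<^esub> \<one>) \<otimes> D" for k l :: int
  proof -
    have "([k] \<cdot>\<^bsub>R\<^esub> \<one>) = ([(k - l)] \<cdot>\<^bsub>R\<^esub> \<one>) \<oplus> ([l] \<cdot>\<^bsub>R\<^esub> \<one>)"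
      using add.int_pow_mult[of \<one> "k - l" l] by simp
    moreover have "[(k - l)] \<cdot>\<^bsub>R\<^esub> \<one> \<in> carrier R" "[l] \<cdot>\<^bsub>R\<^esub> \<one> \<in> carrier R"
      by simp_all
    ultimately show ?thesis
      using D by algebra
  qed
  have "([((forward_diff ^^ n) (\<lambda>k::int. k ^ n - k) 0)] \<cdot>\<^bsub>R\<^esub> \<one>) \<otimes> D = \<zero>"
    by (rule forward_diff_funpow_closed[where P = "\<lambda>k. ([k] \<cdot>\<^bsub>R\<^esub> \<one>) \<otimes> D = \<zero>"])
      (use D in \<open>simp_all add: diff add_pow_int_one_power lin a_minus_def r_neg\<close>)
  moreover have "(forward_diff ^^ n) (\<lambda>k::int. k ^ n - k) 0 = fact n"
    by (simp add: forward_diff_funpow_diff forward_diff_funpow_power forward_diff_funpow_id n)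
  ultimately show ?thesis
    using nonzerodivisorD[OF nonzerodivisor_fact[of n] D] nzd by simp
qed

text \<open>The coefficients are pulled out one at a time. \<open>K\<close> records those already
  replaced by \<open>\<one>\<close>, so that the induction runs on \<open>K\<close> while the domain
  \<open>J\<close> of the homogeneity hypothesis stays fixed.\<close>

lemma separately_homogeneous_eq_finprod:
  assumes "finite K" "K \<subseteq> J" and r: "r \<in> J \<rightarrow> carrier R"
    and closed: "\<And>r. r \<in> J \<rightarrow> carrier R \<Longrightarrow> h r \<in> carrier R"
    and hom: "\<And>r j. r \<in> J \<rightarrow> carrier R \<Longrightarrow> j \<in> J \<Longrightarrow> h r = r j \<otimes> h (r(j := \<one>))"
  shows "h r = finprod R r K \<otimes> h (\<lambda>j. if j \<in> K then \<one> else r j)"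
  using assms(1,2)
proof (induction K rule: finite_induct)
  case empty
  then show ?case using r closed by simp
next
  case (insert x K)
  let ?r = "\<lambda>j. if j \<in> K then \<one> else r j"
  let ?r' = "\<lambda>j. if j \<in> insert x K then \<one> else r j"
  have mem: "x \<in> J" "r x \<in> carrier R" "r \<in> K \<rightarrow> carrier R"
    and r': "?r \<in> J \<rightarrow> carrier R" "?r' \<in> J \<rightarrow> carrier R"
    using insert r by auto
  have upd: "?r(x := \<one>) = ?r'"
    by auto
  have "h ?r = r x \<otimes> h ?r'"
    using hom[OF r'(1) mem(1)] insert(2) by (simp only: upd if_False)
  then show ?case
    using insert mem closed[OF r'(2)] by (simp add: m_ac)
qed

end

section \<open>Affine functions on modules\<close>

context module
begin

lemma affine_linear_on_diff_const:
  assumes f: "affine_linear_on R M m0 N f" "f \<in> carrier M \<rightarrow> carrier R" and a: "a \<in> carrier R"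
    and N: "submodule N R M" and m0: "m0 \<in> carrier M"
  shows "affine_linear_on R M m0 N (\<lambda>x. f x \<ominus> a)"
proof -
  have eq: "f (n \<oplus>\<^bsub>M\<^esub> m1) \<ominus> a \<ominus> (f m1 \<ominus> a) = f (n \<oplus>\<^bsub>M\<^esub> m1) \<ominus> f m1"
    if "m1 \<in> m0 <+\<^bsub>M\<^esub> N" "n \<in> N" for m1 n
  proof -
    have "m1 \<in> carrier M" "n \<in> carrier M"
      using that m0 submoduleE(1)[OF N] by (auto simp: a_l_coset_def l_coset_def)
    then have "f m1 \<in> carrier R" "f (n \<oplus>\<^bsub>M\<^esub> m1) \<in> carrier R"
      using f(2) by auto
    then show ?thesis
      using a by algebra
  qed
  show ?thesis
    using f(1) submoduleE(4,5)[OF N]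
    unfolding affine_linear_on_def linear_functional_on_def Pi_iff
    by (simp add: eq)
qed

text \<open>On all of \<open>M\<close> one base point suffices: additivity of the increments from
  zero shows that the increment by \<open>n\<close> is the same at every \<open>m\<close>.\<close>

lemma affine_linear_on_carrierI:
  assumes f: "f \<in> carrier M \<rightarrow> carrier R"
    and lin: "linear_functional_on R M (carrier M) (\<lambda>x. f x \<ominus> f \<zero>\<^bsub>M\<^esub>)"
  shows "affine_linear_on R M \<zero>\<^bsub>M\<^esub> (carrier M) f"
proof -
  have "f (n \<oplus>\<^bsub>M\<^esub> m) \<ominus> f m = f n \<ominus> f \<zero>\<^bsub>M\<^esub>" if nm: "n \<in> carrier M" "m \<in> carrier M" for n m
  proof -
    have "f (n \<oplus>\<^bsub>M\<^esub> m) \<ominus> f \<zero>\<^bsub>M\<^esub> = (f n \<ominus> f \<zero>\<^bsub>M\<^esub>) \<oplus> (f m \<ominus> f \<zero>\<^bsub>M\<^esub>)"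
      using lin nm unfolding linear_functional_on_def by blast
    moreover have "f n \<in> carrier R" "f m \<in> carrier R" "f \<zero>\<^bsub>M\<^esub> \<in> carrier R" "f (n \<oplus>\<^bsub>M\<^esub> m) \<in> carrier R"
      using f nm by auto
    moreover from this have "f (n \<oplus>\<^bsub>M\<^esub> m) = (f (n \<oplus>\<^bsub>M\<^esub> m) \<ominus> f \<zero>\<^bsub>M\<^esub>) \<oplus> f \<zero>\<^bsub>M\<^esub>"
      by algebra
    ultimately have "f (n \<oplus>\<^bsub>M\<^esub> m) = (f n \<ominus> f \<zero>\<^bsub>M\<^esub>) \<oplus> (f m \<ominus> f \<zero>\<^bsub>M\<^esub>) \<oplus> f \<zero>\<^bsub>M\<^esub>"
      by simp
    then show ?thesis
      using \<open>f n \<in> carrier R\<close> \<open>f m \<in> carrier R\<close> \<open>f \<zero>\<^bsub>M\<^esub> \<in> carrier R\<close> by (simp only:) algebra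
  qed
  moreover have "\<zero>\<^bsub>M\<^esub> <+\<^bsub>M\<^esub> carrier M \<subseteq> carrier M"
    by (auto simp: a_l_coset_def l_coset_def)
  ultimately show ?thesis
    using lin unfolding affine_linear_on_def linear_functional_on_def Pi_iff
    by (simp add: subset_iff)
qed

text \<open>Take \<open>m1 = m0\<close> in the definition and apply homogeneity to \<open>x\<close>,
  a member of its own cyclic submodule. This is the form in which the affinity hypotheses enter the
  argument.\<close>

lemma affine_linear_on_line:
  assumes "affine_linear_on R M m0 (cyclic_submodule R M x) f"
    and "f \<in> carrier M \<rightarrow> carrier R" "m0 \<in> carrier M" "x \<in> carrier M" "s \<in> carrier R"
  shows "f (s \<odot>\<^bsub>M\<^esub> x \<oplus>\<^bsub>M\<^esub> m0) = f m0 \<oplus> s \<otimes> (f (x \<oplus>\<^bsub>M\<^esub> m0) \<ominus> f m0)"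
proof -
  have "\<zero>\<^bsub>M\<^esub> \<in> cyclic_submodule R M x" "x \<in> cyclic_submodule R M x"
    using assms(4) smult_l_null[of x] smult_one[of x]
    unfolding cyclic_submodule_def by (metis (mono_tags, lifting) R.zero_closed R.one_closed mem_Collect_eq)+
  moreover from this(1) have "m0 \<in> m0 <+\<^bsub>M\<^esub> cyclic_submodule R M x"
    using assms(3) by (force simp: a_l_coset_def l_coset_def)
  ultimately have "f (s \<odot>\<^bsub>M\<^esub> x \<oplus>\<^bsub>M\<^esub> m0) \<ominus> f m0 = s \<otimes> (f (x \<oplus>\<^bsub>M\<^esub> m0) \<ominus> f m0)"
    using assms(1,5) unfolding affine_linear_on_def linear_functional_on_def by blast
  moreover have "f (s \<odot>\<^bsub>M\<^esub> x \<oplus>\<^bsub>M\<^esub> m0) \<in> carrier R" "f m0 \<in> carrier R"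
    using assms by auto
  ultimately show ?thesis
    using assms by (metis R.add.inv_solve_right' R.minus_closed R.a_comm a_minus_def)
qed

section \<open>Finite linear combinations of generators\<close>

text \<open>
  Quantifying over all finite supersets of \<open>J\<close> lets two elements be written as combinations over
  a common index set.
\<close>

lemma mem_submodule_generated_imp_lincomb:
  assumes x: "x \<in> submodule_generated R M (e ` I)" and e: "e \<in> I \<rightarrow> carrier M"
  shows "\<exists>J. finite J \<and> J \<subseteq> I \<and> (\<forall>K. finite K \<longrightarrow> J \<subseteq> K \<longrightarrow> K \<subseteq> I \<longrightarrow>
           (\<exists>r \<in> K \<rightarrow> carrier R. x = (\<Oplus>\<^bsub>M\<^esub>j\<in>K. r j \<odot>\<^bsub>M\<^esub> e j)))"
    (is "?P x")
proof -
  have eK: "e \<in> K \<rightarrow> carrier M" if "K \<subseteq> I" for K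
    using that e by auto
  have terms: "(\<lambda>j. r j \<odot>\<^bsub>M\<^esub> e j) \<in> K \<rightarrow> carrier M" if "r \<in> K \<rightarrow> carrier R" "K \<subseteq> I" for r K
    using that e by auto
  have gen: "e ` I \<subseteq> Collect ?P"
  proof clarify
    fix i assume i: "i \<in> I"
    have "\<exists>r \<in> K \<rightarrow> carrier R. e i = (\<Oplus>\<^bsub>M\<^esub>j\<in>K. r j \<odot>\<^bsub>M\<^esub> e j)"
      if K: "finite K" "{i} \<subseteq> K" "K \<subseteq> I" for K
    proof
      \<comment> \<open>A generator has the Kronecker delta as coefficients over any index set
        containing \<open>i\<close>.\<close>
      let ?r = "\<lambda>j. if i = j then \<one> else \<zero>"
      have "(\<Oplus>\<^bsub>M\<^esub>j\<in>K. ?r j \<odot>\<^bsub>M\<^esub> e j) = (\<Oplus>\<^bsub>M\<^esub>j\<in>K. if i = j then e j else \<zero>\<^bsub>M\<^esub>)"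
        using eK[OF K(3)] by (intro M.finsum_cong') (auto simp: Pi_iff)
      also have "\<dots> = e i"
        using eK[OF K(3)] K by (intro M.finsum_singleton) auto
      finally show "e i = (\<Oplus>\<^bsub>M\<^esub>j\<in>K. ?r j \<odot>\<^bsub>M\<^esub> e j)" ..
    qed auto
    then show "?P (e i)"
      using i by (intro exI[of _ "{i}"]) auto
  qed
  have zero: "?P \<zero>\<^bsub>M\<^esub>"
  proof (intro exI[of _ "{}"] conjI allI impI bexI)
    fix K assume "K \<subseteq> I"
    then show "\<zero>\<^bsub>M\<^esub> = (\<Oplus>\<^bsub>M\<^esub>j\<in>K. \<zero> \<odot>\<^bsub>M\<^esub> e j)"
      using eK by (intro M.add.finprod_one_eqI[symmetric]) (auto simp: Pi_iff)
  qed auto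
  have add: "?P (x \<oplus>\<^bsub>M\<^esub> y)" if xy: "?P x" "?P y" for x y
  proof -
    obtain J J' where J: "finite J" "J \<subseteq> I" "finite J'" "J' \<subseteq> I"
      and Jx: "\<And>K. finite K \<Longrightarrow> J \<subseteq> K \<Longrightarrow> K \<subseteq> I \<Longrightarrow> \<exists>r \<in> K \<rightarrow> carrier R. x = (\<Oplus>\<^bsub>M\<^esub>j\<in>K. r j \<odot>\<^bsub>M\<^esub> e j)"
      and Jy: "\<And>K. finite K \<Longrightarrow> J' \<subseteq> K \<Longrightarrow> K \<subseteq> I \<Longrightarrow> \<exists>r \<in> K \<rightarrow> carrier R. y = (\<Oplus>\<^bsub>M\<^esub>j\<in>K. r j \<odot>\<^bsub>M\<^esub> e j)"
      using xy by (elim exE conjE) blast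
    have "\<exists>r \<in> K \<rightarrow> carrier R. x \<oplus>\<^bsub>M\<^esub> y = (\<Oplus>\<^bsub>M\<^esub>j\<in>K. r j \<odot>\<^bsub>M\<^esub> e j)"
      if K: "finite K" "J \<union> J' \<subseteq> K" "K \<subseteq> I" for K
    proof -
      obtain r s where rs: "r \<in> K \<rightarrow> carrier R" "s \<in> K \<rightarrow> carrier R"
        and eq: "x = (\<Oplus>\<^bsub>M\<^esub>j\<in>K. r j \<odot>\<^bsub>M\<^esub> e j)" "y = (\<Oplus>\<^bsub>M\<^esub>j\<in>K. s j \<odot>\<^bsub>M\<^esub> e j)"
        using Jx[of K] Jy[of K] K by auto
      have "x \<oplus>\<^bsub>M\<^esub> y = (\<Oplus>\<^bsub>M\<^esub>j\<in>K. r j \<odot>\<^bsub>M\<^esub> e j \<oplus>\<^bsub>M\<^esub> s j \<odot>\<^bsub>M\<^esub> e j)"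
        using terms rs K(3) by (simp add: eq M.finsum_addf)
      also have "\<dots> = (\<Oplus>\<^bsub>M\<^esub>j\<in>K. (r j \<oplus> s j) \<odot>\<^bsub>M\<^esub> e j)"
        using rs eK[OF K(3)] by (intro M.finsum_cong') (auto simp: smult_l_distr Pi_iff)
      finally show ?thesis
        using rs by (intro bexI[of _ "\<lambda>j. r j \<oplus> s j"]) auto
    qed
    then show ?thesis
      using J by (intro exI[of _ "J \<union> J'"]) auto
  qed
  have smult: "?P (a \<odot>\<^bsub>M\<^esub> x)" if xa: "?P x" "a \<in> carrier R" for x a
  proof -
    obtain J where J: "finite J" "J \<subseteq> I"
      and Jx: "\<And>K. finite K \<Longrightarrow> J \<subseteq> K \<Longrightarrow> K \<subseteq> I \<Longrightarrow> \<exists>r \<in> K \<rightarrow> carrier R. x = (\<Oplus>\<^bsub>M\<^esub>j\<in>K. r j \<odot>\<^bsub>M\<^esub> e j)"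
      using xa(1) by (elim exE conjE) blast
    have "\<exists>r \<in> K \<rightarrow> carrier R. a \<odot>\<^bsub>M\<^esub> x = (\<Oplus>\<^bsub>M\<^esub>j\<in>K. r j \<odot>\<^bsub>M\<^esub> e j)"
      if K: "finite K" "J \<subseteq> K" "K \<subseteq> I" for K
    proof -
      obtain r where r: "r \<in> K \<rightarrow> carrier R"
        and eq: "x = (\<Oplus>\<^bsub>M\<^esub>j\<in>K. r j \<odot>\<^bsub>M\<^esub> e j)"
        using Jx[of K] K by auto
      have "a \<odot>\<^bsub>M\<^esub> x = (\<Oplus>\<^bsub>M\<^esub>j\<in>K. a \<odot>\<^bsub>M\<^esub> (r j \<odot>\<^bsub>M\<^esub> e j))"
        using terms[OF r K(3)] K xa by (simp add: eq finsum_smult_ldistr)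
      also have "\<dots> = (\<Oplus>\<^bsub>M\<^esub>j\<in>K. (a \<otimes> r j) \<odot>\<^bsub>M\<^esub> e j)"
        using r eK[OF K(3)] xa by (intro M.finsum_cong') (auto simp: smult_assoc1 Pi_iff)
      finally show ?thesis
        using r xa by (intro bexI[of _ "\<lambda>j. a \<otimes> r j"]) auto
    qed
    then show ?thesis
      using J by (intro exI[of _ J]) auto
  qed
  have carr: "x \<in> carrier M" if x: "?P x" for x
  proof -
    obtain J r where "J \<subseteq> I" "r \<in> J \<rightarrow> carrier R" "x = (\<Oplus>\<^bsub>M\<^esub>j\<in>J. r j \<odot>\<^bsub>M\<^esub> e j)"
      using x by blast
    then show ?thesis
      using terms by (simp add: M.finsum_closed)
  qed
  have minus: "?P (\<ominus>\<^bsub>M\<^esub> x)" if "?P x" for x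
    using smult[OF that, of "\<ominus> \<one>"] carr[OF that] by (simp add: smult_l_minus)
  have "submodule (Collect ?P) R M"
  proof (rule submoduleI)
    show "Collect ?P \<subseteq> carrier M"
      by (rule subsetI, drule CollectD, erule carr)
    show "\<zero>\<^bsub>M\<^esub> \<in> Collect ?P"
      using zero by (rule CollectI)
    show "\<ominus>\<^bsub>M\<^esub> x \<in> Collect ?P" if "x \<in> Collect ?P" for x
      using minus[OF CollectD[OF that]] by (rule CollectI)
    show "x \<oplus>\<^bsub>M\<^esub> y \<in> Collect ?P" if "x \<in> Collect ?P" "y \<in> Collect ?P" for x y
      using add[OF CollectD[OF that(1)] CollectD[OF that(2)]] by (rule CollectI)
    show "a \<odot>\<^bsub>M\<^esub> x \<in> Collect ?P" if "a \<in> carrier R" "x \<in> Collect ?P" for a x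
      using smult[OF CollectD[OF that(2)] that(1)] by (rule CollectI)
  qed
  \<comment> \<open>The elements with the property form a submodule containing the generators, and
    the generated submodule is the least such.\<close>
  then have "submodule_generated R M (e ` I) \<subseteq> Collect ?P"
    unfolding submodule_generated_def using gen by (intro hull_minimal)
  then show ?thesis
    using x by blast
qed

section \<open>Vanishing of the defect of linearity\<close>

text \<open>Induction over proper subsets removes all contributions to the defect except a multiple
  of the product of all coefficients, and \<open>diag\<close> removes that one. From the special
  vectors, \<open>diag\<close> keeps just what is needed: cancellable coefficients and homogeneity
  of \<open>g\<close> along the line they span.\<close>

lemma lincomb_of_affine_lines:
  assumes e: "e \<in> I \<rightarrow> carrier M"
    and nzd: "\<And>n::nat. 1 \<le> n \<Longrightarrow> infinite I \<or> n \<le> card I \<Longrightarrow> nonzerodivisor R ([n] \<cdot>\<^bsub>R\<^esub> \<one>)"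
    and g: "g \<in> carrier M \<rightarrow> carrier R" "g \<zero>\<^bsub>M\<^esub> = \<zero>"
    and lines: "\<And>x i s. x \<in> carrier M \<Longrightarrow> i \<in> I \<Longrightarrow> s \<in> carrier R \<Longrightarrow>
      g (s \<odot>\<^bsub>M\<^esub> e i \<oplus>\<^bsub>M\<^esub> x) = g x \<oplus> s \<otimes> (g (e i \<oplus>\<^bsub>M\<^esub> x) \<ominus> g x)"
    and diag: "\<And>J. finite J \<Longrightarrow> J \<subseteq> I \<Longrightarrow> 2 \<le> card J \<Longrightarrow>
      \<exists>c. (\<forall>j\<in>J. nonzerodivisor R (c j)) \<and>
          (\<forall>t\<in>carrier R. g (t \<odot>\<^bsub>M\<^esub> (\<Oplus>\<^bsub>M\<^esub>j\<in>J. c j \<odot>\<^bsub>M\<^esub> e j)) = t \<otimes> g (\<Oplus>\<^bsub>M\<^esub>j\<in>J. c j \<odot>\<^bsub>M\<^esub> e j))"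
    and "finite J" "J \<subseteq> I" "r \<in> J \<rightarrow> carrier R"
  shows "g (\<Oplus>\<^bsub>M\<^esub>j\<in>J. r j \<odot>\<^bsub>M\<^esub> e j) = (\<Oplus>j\<in>J. r j \<otimes> g (e j))"
  using assms(7-)
proof (induction J arbitrary: r rule: finite_psubset_induct)
  case (psubset J)
  define h where "h r = g (\<Oplus>\<^bsub>M\<^esub>j\<in>J. r j \<odot>\<^bsub>M\<^esub> e j) \<ominus> (\<Oplus>j\<in>J. r j \<otimes> g (e j))" for r
  have eJ: "e j \<in> carrier M" "g (e j) \<in> carrier R" if "j \<in> J" for j
    using that e g psubset.prems(1) by auto
  have closed: "(\<Oplus>\<^bsub>M\<^esub>j\<in>K. r j \<odot>\<^bsub>M\<^esub> e j) \<in> carrier M" "(\<Oplus>j\<in>K. r j \<otimes> g (e j)) \<in> carrier R"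
    if "r \<in> K \<rightarrow> carrier R" "K \<subseteq> J" for r K
    using that eJ by (auto simp: Pi_iff subset_iff intro!: M.finsum_closed R.finsum_closed)
  have gM: "g x \<in> carrier R" if "x \<in> carrier M" for x
    using that g by auto
  have h_closed: "h r \<in> carrier R" if "r \<in> J \<rightarrow> carrier R" for r
    using that closed[of r J] gM by (simp add: h_def)
  have h_cong: "h r = h s" if "s \<in> J \<rightarrow> carrier R" "\<And>j. j \<in> J \<Longrightarrow> r j = s j" for r s
  proof -
    have "(\<Oplus>\<^bsub>M\<^esub>j\<in>J. r j \<odot>\<^bsub>M\<^esub> e j) = (\<Oplus>\<^bsub>M\<^esub>j\<in>J. s j \<odot>\<^bsub>M\<^esub> e j)"
      using that eJ by (intro M.finsum_cong') auto
    moreover have "(\<Oplus>j\<in>J. r j \<otimes> g (e j)) = (\<Oplus>j\<in>J. s j \<otimes> g (e j))"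
      using that eJ by (intro R.finsum_cong') auto
    ultimately show ?thesis by (simp add: h_def)
  qed
  \<comment> \<open>The induction hypothesis for \<open>J - {j}\<close> turns the remaining sum of
    values into one value of \<open>g\<close>, so \<open>h\<close> becomes the defect of additivity
    of two summands.\<close>
  have h_split: "h r = g (r j \<odot>\<^bsub>M\<^esub> e j \<oplus>\<^bsub>M\<^esub> (\<Oplus>\<^bsub>M\<^esub>i\<in>J-{j}. r i \<odot>\<^bsub>M\<^esub> e i))
      \<ominus> (r j \<otimes> g (e j) \<oplus> g (\<Oplus>\<^bsub>M\<^esub>i\<in>J-{j}. r i \<odot>\<^bsub>M\<^esub> e i))"
    if r: "r \<in> J \<rightarrow> carrier R" and j: "j \<in> J" for r j
  proof -
    have J: "J = insert j (J - {j})" "finite (J - {j})"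
      using j psubset.hyps by auto
    have r': "r \<in> J - {j} \<rightarrow> carrier R"
      using r by auto
    have "(\<Oplus>\<^bsub>M\<^esub>i\<in>J. r i \<odot>\<^bsub>M\<^esub> e i) = r j \<odot>\<^bsub>M\<^esub> e j \<oplus>\<^bsub>M\<^esub> (\<Oplus>\<^bsub>M\<^esub>i\<in>J-{j}. r i \<odot>\<^bsub>M\<^esub> e i)"
      using eJ r j by (subst J(1), subst M.finsum_insert[OF J(2)]) auto
    moreover have "(\<Oplus>i\<in>J. r i \<otimes> g (e i)) = r j \<otimes> g (e j) \<oplus> (\<Oplus>i\<in>J-{j}. r i \<otimes> g (e i))"
      using eJ r j by (subst J(1), subst R.finsum_insert[OF J(2)]) auto
    moreover have "g (\<Oplus>\<^bsub>M\<^esub>i\<in>J-{j}. r i \<odot>\<^bsub>M\<^esub> e i) = (\<Oplus>i\<in>J-{j}. r i \<otimes> g (e i))"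
      using psubset.prems j r' by (intro psubset.IH) auto
    ultimately show ?thesis
      by (simp add: h_def)
  qed
  have h_hom: "h r = r j \<otimes> h (r(j := \<one>))" if r: "r \<in> J \<rightarrow> carrier R" and j: "j \<in> J" for r j
  proof -
    let ?x = "\<Oplus>\<^bsub>M\<^esub>i\<in>J-{j}. r i \<odot>\<^bsub>M\<^esub> e i"
    have x: "?x \<in> carrier M"
      using closed[of r "J - {j}"] r by auto
    have rj: "r j \<in> carrier R" "j \<in> I"
      using r j psubset.prems(1) by auto
    \<comment> \<open>Changing the coefficient at \<open>j\<close> leaves the base point
      \<open>?x\<close> alone, so \<open>h r\<close> and \<open>h (r(j := \<one>))\<close> are
      compared on one line in direction \<open>e j\<close>.\<close>
    have "(\<Oplus>\<^bsub>M\<^esub>i\<in>J-{j}. (r(j := \<one>)) i \<odot>\<^bsub>M\<^esub> e i) = ?x"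
      using eJ r by (intro M.finsum_cong') auto
    moreover have "r(j := \<one>) \<in> J \<rightarrow> carrier R"
      using r by auto
    ultimately have 1: "h (r(j := \<one>)) = g (e j \<oplus>\<^bsub>M\<^esub> ?x) \<ominus> (g (e j) \<oplus> g ?x)"
      using h_split[of "r(j := \<one>)" j] j eJ[OF j] by simp
    have 2: "h r = g ?x \<oplus> r j \<otimes> (g (e j \<oplus>\<^bsub>M\<^esub> ?x) \<ominus> g ?x) \<ominus> (r j \<otimes> g (e j) \<oplus> g ?x)"
      using h_split[OF r j] lines[OF x rj(2) rj(1)] by simp
    have "g ?x \<in> carrier R" "g (e j \<oplus>\<^bsub>M\<^esub> ?x) \<in> carrier R"
      using gM x eJ[OF j] by auto
    moreover have "a \<oplus> s \<otimes> (b \<ominus> a) \<ominus> (s \<otimes> d \<oplus> a) = s \<otimes> (b \<ominus> (d \<oplus> a))"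
      if "a \<in> carrier R" "b \<in> carrier R" "d \<in> carrier R" "s \<in> carrier R" for a b d s
      using that by algebra
    ultimately show ?thesis
      unfolding 1 2 using rj(1) eJ(2)[OF j] by blast
  qed
  have h_prod: "h r = finprod R r J \<otimes> h (\<lambda>_. \<one>)" if r: "r \<in> J \<rightarrow> carrier R" for r
  proof -
    have "h r = finprod R r J \<otimes> h (\<lambda>j. if j \<in> J then \<one> else r j)"
      by (rule separately_homogeneous_eq_finprod[OF psubset.hyps order_refl r h_closed h_hom])
    \<comment> \<open>Only the values on \<open>J\<close> matter for \<open>h\<close>, so the
      coefficients outside may be set to \<open>\<one>\<close> too.\<close>
    also have "h (\<lambda>j. if j \<in> J then \<one> else r j) = h (\<lambda>_. \<one>)"
      by (rule h_cong) auto
    finally show ?thesis .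
  qed
  have h_1: "h (\<lambda>_. \<one>) = \<zero>"
  proof -
    \<comment> \<open>The comparison of \<open>t ^ n\<close> with \<open>t\<close> says nothing for
      \<open>n = 1\<close>, so sets with fewer than two elements are treated directly; there the
      defect at \<open>\<one>\<close> is zero by cancellation or by \<open>g\<close> vanishing at
      zero.\<close>
    consider "card J = 0" | "card J = 1" | "2 \<le> card J"
      by linarith
    then show ?thesis
    proof cases
      case 1
      then have "J = {}"
        using psubset.hyps by simp
      then show ?thesis
        using g by (simp add: h_def a_minus_def)
    next
      case 2
      then obtain j where "J = {j}"
        by (rule card_1_singletonE)
      then show ?thesis
        using eJ[of j] by (simp add: h_def a_minus_def R.r_neg)
    next
      case 3
      then obtain c where c: "\<And>j. j \<in> J \<Longrightarrow> nonzerodivisor R (c j)"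
        and lin: "\<And>t. t \<in> carrier R \<Longrightarrow>
          g (t \<odot>\<^bsub>M\<^esub> (\<Oplus>\<^bsub>M\<^esub>j\<in>J. c j \<odot>\<^bsub>M\<^esub> e j)) = t \<otimes> g (\<Oplus>\<^bsub>M\<^esub>j\<in>J. c j \<odot>\<^bsub>M\<^esub> e j)"
        using diag[OF psubset.hyps psubset.prems(1)] by metis
      have cJ: "c \<in> J \<rightarrow> carrier R"
        using c by (auto intro: nonzerodivisor_closed)
      have "h c = \<zero>"
      proof (rule R.monomial_linear_imp_zero[OF h_closed[OF cJ] 3])
        fix t assume t: "t \<in> carrier R"
        have tc: "(\<lambda>j. t \<otimes> c j) \<in> J \<rightarrow> carrier R"
          using cJ t by auto
        have "(\<Oplus>\<^bsub>M\<^esub>j\<in>J. (t \<otimes> c j) \<odot>\<^bsub>M\<^esub> e j) = (\<Oplus>\<^bsub>M\<^esub>j\<in>J. t \<odot>\<^bsub>M\<^esub> (c j \<odot>\<^bsub>M\<^esub> e j))"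
          using eJ cJ t by (intro M.finsum_cong') (auto simp: smult_assoc1 Pi_iff)
        also have "\<dots> = t \<odot>\<^bsub>M\<^esub> (\<Oplus>\<^bsub>M\<^esub>j\<in>J. c j \<odot>\<^bsub>M\<^esub> e j)"
          using eJ cJ t psubset.hyps by (intro finsum_smult_ldistr[symmetric]) auto
        finally have 1: "g (\<Oplus>\<^bsub>M\<^esub>j\<in>J. (t \<otimes> c j) \<odot>\<^bsub>M\<^esub> e j) = t \<otimes> g (\<Oplus>\<^bsub>M\<^esub>j\<in>J. c j \<odot>\<^bsub>M\<^esub> e j)"
          using lin[OF t] by simp
        have "(\<Oplus>j\<in>J. (t \<otimes> c j) \<otimes> g (e j)) = (\<Oplus>j\<in>J. t \<otimes> (c j \<otimes> g (e j)))"
          using eJ cJ t by (intro R.finsum_cong') (auto simp: R.m_assoc Pi_iff)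
        also have "\<dots> = t \<otimes> (\<Oplus>j\<in>J. c j \<otimes> g (e j))"
          using eJ cJ t psubset.hyps by (intro R.finsum_rdistr[symmetric]) auto
        finally have 2: "(\<Oplus>j\<in>J. (t \<otimes> c j) \<otimes> g (e j)) = t \<otimes> (\<Oplus>j\<in>J. c j \<otimes> g (e j))" .
        \<comment> \<open>Both parts of the defect scale by \<open>t\<close> on this line, whereas
          \<open>h_prod\<close> scales it by one factor \<open>t\<close> for each element of
          \<open>J\<close>.\<close>
        have "t \<otimes> h c = h (\<lambda>j. t \<otimes> c j)"
          unfolding h_def 1 2 using closed[OF cJ order_refl] gM t
          by (simp add: a_minus_def R.r_distr R.r_minus)
        also have "\<dots> = finprod R (\<lambda>j. t \<otimes> c j) J \<otimes> h (\<lambda>_. \<one>)"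
          by (rule h_prod[OF tc])
        also have "finprod R (\<lambda>j. t \<otimes> c j) J = t [^] card J \<otimes> finprod R c J"
          using cJ t by (simp add: R.finprod_multf R.finprod_const)
        also have "\<dots> \<otimes> h (\<lambda>_. \<one>) = t [^] card J \<otimes> h c"
          using h_prod[OF cJ] h_closed[of "\<lambda>_. \<one>"] cJ t by (simp add: R.m_assoc)
        finally show "t [^] card J \<otimes> h c = t \<otimes> h c" ..
      next
        fix k :: nat assume k: "1 \<le> k" "k \<le> card J"
        \<comment> \<open>\<open>card I\<close> is \<open>0\<close> for infinite \<open>I\<close>,
          so the bound on \<open>k\<close> needs the infinite case as a separate
          alternative.\<close>
        have "infinite I \<or> card J \<le> card I"
          using psubset.prems(1) by (meson card_mono)
        then show "nonzerodivisor R ([k] \<cdot>\<^bsub>R\<^esub> \<one>)"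
          using k by (intro nzd) auto
      qed
      \<comment> \<open>By \<open>h_prod\<close>, \<open>h c\<close> is the product of the
        \<open>c j\<close> times the defect at \<open>\<one>\<close>, and that product is a
        non-zerodivisor.\<close>
      then show ?thesis
        using h_prod[OF cJ] h_closed[of "\<lambda>_. \<one>"]
          nonzerodivisorD[OF R.nonzerodivisor_finprod[OF psubset.hyps(1) c]]
        by simp
    qed
  qed
  have "h r = \<zero>"
    using h_prod[OF psubset.prems(2)] h_1 psubset.prems(2) by simp
  then show ?case
    unfolding h_def
    by (rule R.minus_eq_zeroD[OF _ gM]) (fact closed[OF psubset.prems(2) order_refl])+
qed

section \<open>From linear combinations to the whole module\<close>

text \<open>Two elements are written over a common finite index set, where coefficients add and
  scale. The coefficients need not be unique, which is harmless because \<open>g\<close> is already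
  a function of the element.\<close>

lemma linear_functional_on_of_lincomb:
  assumes e: "e \<in> I \<rightarrow> carrier M" and gen: "submodule_generated R M (e ` I) = carrier M"
    and g: "g \<in> carrier M \<rightarrow> carrier R"
    and lincomb: "\<And>J r. finite J \<Longrightarrow> J \<subseteq> I \<Longrightarrow> r \<in> J \<rightarrow> carrier R \<Longrightarrow>
      g (\<Oplus>\<^bsub>M\<^esub>j\<in>J. r j \<odot>\<^bsub>M\<^esub> e j) = (\<Oplus>j\<in>J. r j \<otimes> g (e j))"
  shows "linear_functional_on R M (carrier M) g"
  unfolding linear_functional_on_def
proof (intro conjI ballI)
  have ge: "g (e j) \<in> carrier R" "e j \<in> carrier M" if "j \<in> I" for j
    using that e g by auto
  note repr = mem_submodule_generated_imp_lincomb[OF _ e, unfolded gen]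
  {
    fix x y assume x: "x \<in> carrier M" and y: "y \<in> carrier M"
    obtain J J' where J: "finite J" "J \<subseteq> I" "finite J'" "J' \<subseteq> I"
      and Jx: "\<And>K. finite K \<Longrightarrow> J \<subseteq> K \<Longrightarrow> K \<subseteq> I \<Longrightarrow> \<exists>r \<in> K \<rightarrow> carrier R. x = (\<Oplus>\<^bsub>M\<^esub>j\<in>K. r j \<odot>\<^bsub>M\<^esub> e j)"
      and Jy: "\<And>K. finite K \<Longrightarrow> J' \<subseteq> K \<Longrightarrow> K \<subseteq> I \<Longrightarrow> \<exists>r \<in> K \<rightarrow> carrier R. y = (\<Oplus>\<^bsub>M\<^esub>j\<in>K. r j \<odot>\<^bsub>M\<^esub> e j)"
      using repr[OF x] repr[OF y] by (elim exE conjE) blast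
    define K where "K = J \<union> J'"
    have K: "finite K" "K \<subseteq> I" "J \<subseteq> K" "J' \<subseteq> K"
      using J by (auto simp: K_def)
    obtain r s where rs: "r \<in> K \<rightarrow> carrier R" "s \<in> K \<rightarrow> carrier R"
      and eq: "x = (\<Oplus>\<^bsub>M\<^esub>j\<in>K. r j \<odot>\<^bsub>M\<^esub> e j)" "y = (\<Oplus>\<^bsub>M\<^esub>j\<in>K. s j \<odot>\<^bsub>M\<^esub> e j)"
      using Jx[of K] Jy[of K] K by auto
    have "x \<oplus>\<^bsub>M\<^esub> y = (\<Oplus>\<^bsub>M\<^esub>j\<in>K. r j \<odot>\<^bsub>M\<^esub> e j \<oplus>\<^bsub>M\<^esub> s j \<odot>\<^bsub>M\<^esub> e j)"
      unfolding eq using rs K ge by (intro M.finsum_addf[symmetric]) (auto simp: Pi_iff subset_iff)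
    also have "\<dots> = (\<Oplus>\<^bsub>M\<^esub>j\<in>K. (r j \<oplus> s j) \<odot>\<^bsub>M\<^esub> e j)"
      using rs K ge by (intro M.finsum_cong') (auto simp: smult_l_distr Pi_iff subset_iff)
    finally have "g (x \<oplus>\<^bsub>M\<^esub> y) = g (\<Oplus>\<^bsub>M\<^esub>j\<in>K. (r j \<oplus> s j) \<odot>\<^bsub>M\<^esub> e j)"
      by simp
    also have "\<dots> = (\<Oplus>j\<in>K. (r j \<oplus> s j) \<otimes> g (e j))"
      using rs K by (intro lincomb) auto
    also have "\<dots> = (\<Oplus>j\<in>K. r j \<otimes> g (e j) \<oplus> s j \<otimes> g (e j))"
      using rs K ge by (intro R.finsum_cong') (auto simp: R.l_distr Pi_iff subset_iff)
    also have "\<dots> = (\<Oplus>j\<in>K. r j \<otimes> g (e j)) \<oplus> (\<Oplus>j\<in>K. s j \<otimes> g (e j))"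
      using rs K ge by (intro R.finsum_addf) (auto simp: Pi_iff subset_iff)
    finally show "g (x \<oplus>\<^bsub>M\<^esub> y) = g x \<oplus> g y"
      using lincomb rs K by (simp add: eq)
  }
  {
    fix a x assume a: "a \<in> carrier R" and "x \<in> carrier M"
    then obtain K r where K: "finite K" "K \<subseteq> I" and r: "r \<in> K \<rightarrow> carrier R"
      and eq: "x = (\<Oplus>\<^bsub>M\<^esub>j\<in>K. r j \<odot>\<^bsub>M\<^esub> e j)"
      using repr[of x] by blast
    have "a \<odot>\<^bsub>M\<^esub> x = (\<Oplus>\<^bsub>M\<^esub>j\<in>K. a \<odot>\<^bsub>M\<^esub> (r j \<odot>\<^bsub>M\<^esub> e j))"
      unfolding eq using r a K ge by (intro finsum_smult_ldistr) (auto simp: Pi_iff subset_iff)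
    also have "\<dots> = (\<Oplus>\<^bsub>M\<^esub>j\<in>K. (a \<otimes> r j) \<odot>\<^bsub>M\<^esub> e j)"
      using r a K ge by (intro M.finsum_cong') (auto simp: smult_assoc1 Pi_iff subset_iff)
    finally have "g (a \<odot>\<^bsub>M\<^esub> x) = g (\<Oplus>\<^bsub>M\<^esub>j\<in>K. (a \<otimes> r j) \<odot>\<^bsub>M\<^esub> e j)"
      by simp
    also have "\<dots> = (\<Oplus>j\<in>K. (a \<otimes> r j) \<otimes> g (e j))"
      using r a K by (intro lincomb) auto
    also have "\<dots> = (\<Oplus>j\<in>K. a \<otimes> (r j \<otimes> g (e j)))"
      using r a K ge by (intro R.finsum_cong') (auto simp: R.m_assoc Pi_iff subset_iff)
    also have "\<dots> = a \<otimes> (\<Oplus>j\<in>K. r j \<otimes> g (e j))"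
      using r a K ge by (intro R.finsum_rdistr[symmetric]) (auto simp: Pi_iff subset_iff)
    finally show "g (a \<odot>\<^bsub>M\<^esub> x) = a \<otimes> g x"
      using lincomb r K by (simp add: eq)
  }
qed (fact g)

end

section \<open>Reduction to functions vanishing at zero\<close>

theorem corollary1p4:
  fixes R :: "('a, 'c) ring_scheme"
    and M :: "('a, 'b, 'd) module_scheme"
    and I :: "'i set"
    and e :: "'i \<Rightarrow> 'b"
    and c :: "'i set \<Rightarrow> 'i \<Rightarrow> 'a"
    and m :: "'i set \<Rightarrow> 'b"
    and f :: "'b \<Rightarrow> 'a"
  assumes "Module.module R M"
    and "e \<in> I \<rightarrow> carrier M"
    and "submodule_generated R M (e ` I) = carrier M"
    and "\<And>n::nat. 1 \<le> n \<Longrightarrow> infinite I \<or> n \<le> card I \<Longrightarrow>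
           nonzerodivisor R ([n] \<cdot>\<^bsub>R\<^esub> \<one>\<^bsub>R\<^esub>)"
    and "\<And>J j. finite J \<Longrightarrow> J \<subseteq> I \<Longrightarrow> j \<in> J \<Longrightarrow> nonzerodivisor R (c J j)"
    and "\<And>J. finite J \<Longrightarrow> J \<subseteq> I \<Longrightarrow> m J = (\<Oplus>\<^bsub>M\<^esub>j\<in>J. c J j \<odot>\<^bsub>M\<^esub> e j)"
    and "f \<in> carrier M \<rightarrow> carrier R"
    and "\<And>m0 i. m0 \<in> carrier M \<Longrightarrow> i \<in> I \<Longrightarrow>
           affine_linear_on R M m0 (cyclic_submodule R M (e i)) f"
    and "\<And>J. finite J \<Longrightarrow> J \<subseteq> I \<Longrightarrow> card J \<ge> 2 \<Longrightarrow>
           affine_linear_on R M \<zero>\<^bsub>M\<^esub> (cyclic_submodule R M (m J)) f"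
  shows "affine_linear_on R M \<zero>\<^bsub>M\<^esub> (carrier M) f"
proof -
  interpret module R M by fact
  note e = assms(2) and f = assms(7)
  define g where "g = (\<lambda>x. f x \<ominus>\<^bsub>R\<^esub> f \<zero>\<^bsub>M\<^esub>)"
  have f0: "f \<zero>\<^bsub>M\<^esub> \<in> carrier R"
    using f by auto
  have g: "g \<in> carrier M \<rightarrow> carrier R" "g \<zero>\<^bsub>M\<^esub> = \<zero>\<^bsub>R\<^esub>"
    using f f0 by (auto simp: g_def a_minus_def R.r_neg)
  \<comment> \<open>Subtracting the constant preserves affinity, so each line given for
    \<open>f\<close> yields the pointwise formula for \<open>g\<close>.\<close>
  have g_affine: "g (s \<odot>\<^bsub>M\<^esub> x \<oplus>\<^bsub>M\<^esub> m0) = g m0 \<oplus>\<^bsub>R\<^esub> s \<otimes>\<^bsub>R\<^esub> (g (x \<oplus>\<^bsub>M\<^esub> m0) \<ominus>\<^bsub>R\<^esub> g m0)"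
    if "affine_linear_on R M m0 (cyclic_submodule R M x) f"
      "m0 \<in> carrier M" "x \<in> carrier M" "s \<in> carrier R" for s x m0
    using affine_linear_on_line[of m0 x g s] that f f0 g(1)
      affine_linear_on_diff_const[OF that(1)] cyclic_submodule_is_submodule
    by (simp add: g_def)
  have "linear_functional_on R M (carrier M) g"
  proof (rule linear_functional_on_of_lincomb[OF e assms(3) g(1)])
    fix J r assume J: "finite J" "J \<subseteq> I" "r \<in> J \<rightarrow> carrier R"
    show "g (\<Oplus>\<^bsub>M\<^esub>j\<in>J. r j \<odot>\<^bsub>M\<^esub> e j) = (\<Oplus>\<^bsub>R\<^esub>j\<in>J. r j \<otimes>\<^bsub>R\<^esub> g (e j))"
    proof (rule lincomb_of_affine_lines[OF e assms(4) g _ _ J])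
      fix x i s assume "x \<in> carrier M" "i \<in> I" "s \<in> carrier R"
      then show "g (s \<odot>\<^bsub>M\<^esub> e i \<oplus>\<^bsub>M\<^esub> x) = g x \<oplus>\<^bsub>R\<^esub> s \<otimes>\<^bsub>R\<^esub> (g (e i \<oplus>\<^bsub>M\<^esub> x) \<ominus>\<^bsub>R\<^esub> g x)"
        using assms(8) e by (intro g_affine) auto
    next
      fix K assume K: "finite K" "K \<subseteq> I" "2 \<le> card K"
      have cK: "nonzerodivisor R (c K j)" if "j \<in> K" for j
        using assms(5) K that by blast
      have mK: "m K = (\<Oplus>\<^bsub>M\<^esub>j\<in>K. c K j \<odot>\<^bsub>M\<^esub> e j)"
        using assms(6) K by blast
      have "(\<lambda>j. c K j \<odot>\<^bsub>M\<^esub> e j) \<in> K \<rightarrow> carrier M"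
        using cK e K by (auto intro: nonzerodivisor_closed)
      then have mK_closed: "m K \<in> carrier M"
        by (simp add: mK)
      \<comment> \<open>With base point zero, where \<open>g\<close> vanishes, the affine formula
        reduces to homogeneity.\<close>
      have "g (t \<odot>\<^bsub>M\<^esub> m K) = t \<otimes>\<^bsub>R\<^esub> g (m K)" if "t \<in> carrier R" for t
      proof -
        have "g (m K) \<in> carrier R"
          using g mK_closed by auto
        then show ?thesis
          using g_affine[OF assms(9)[OF K] _ mK_closed that] mK_closed that g
          by (simp add: a_minus_def)
      qed
      then show "\<exists>c. (\<forall>j\<in>K. nonzerodivisor R (c j)) \<and>
          (\<forall>t\<in>carrier R. g (t \<odot>\<^bsub>M\<^esub> (\<Oplus>\<^bsub>M\<^esub>j\<in>K. c j \<odot>\<^bsub>M\<^esub> e j)) =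
             t \<otimes>\<^bsub>R\<^esub> g (\<Oplus>\<^bsub>M\<^esub>j\<in>K. c j \<odot>\<^bsub>M\<^esub> e j))"
        unfolding mK using cK by blast
    qed
  qed
  then show ?thesis
    using f unfolding g_def by (intro affine_linear_on_carrierI)
qed

end
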